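(* Consider a univariate exponential family of pdfs or pmfs $f(x,\theta)=v(x)\exp(\eta(\theta)u(x)-\zeta(\theta))$, $\theta\in\Theta$, with known functions $u,v,\eta,\zeta$ and $\eta,\zeta$ differentiable. Let $\mu(\theta)=\mathbb{E}_\theta[u(X)]$. Let $X,X_1,\dots,X_n$ be i.i.d. with pdf or pmf $f(\cdot,\theta)$ and $Z=\frac1n\sum_{i=1}^nu(X_i)$. Let $\alpha\in\Theta$ and $z=\mu(\alpha)$. For $\vartheta\in\Theta$ define $\rho(z,\vartheta)=[\eta(\theta)-\eta(\vartheta)]z-\zeta(\theta)+\zeta(\vartheta)$. Let $\mathscr{C}$ be the Berry–Esseen constant and $$\varDelta=\min\Big\{\frac12,\ \frac{\mathscr{C}}{\sqrt n}\,\frac{\mathbb{E}_\alpha[|u(X)-z|^3]}{\mathbb{E}_\alpha^{3/2}[|u(X)-z|^2]}\Big\}.$$ Then: (I) If $\mu(\theta)\le z$ and $\Pr\{u(X)<z\mid\theta\}>0$, then $\Pr\{Z\ge z\mid\theta\}\le\exp(n\rho(z,\alpha))$ and $\lim_{n\to\infty}\frac1n\ln\Pr\{Z\ge z\mid\theta\}=\rho(z,\alpha)$. (II) If $\mu(\theta)\ge z$ and $\Pr\{u(X)>z\mid\theta\}>0$, then $\Pr\{Z\le z\mid\theta\}\le\exp(n\rho(z,\alpha))$ and $\lim_{n\to\infty}\frac1n\ln\Pr\{Z\le z\mid\theta\}=\rho(z,\alpha)$. (III) If $\eta(\theta)\le\eta(\alpha)$, then $\Pr\{Z\ge z\mid\theta\}\le\exp(n\rho(z,\alpha))\Pr\{Z\ge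 z\mid\alpha\}\le(\frac12+\varDelta)\exp(n\rho(z,\alpha))$. (IV) If $\eta(\theta)\ge\eta(\alpha)$, then $\Pr\{Z\le z\mid\theta\}\le\exp(n\rho(z,\alpha))\Pr\{Z\le z\mid\alpha\}\le(\frac12+\varDelta)\exp(n\rho(z,\alpha))$.
   Context: $\mathbb{E}_\alpha$ denotes expectation when $X$ has pdf or pmf $f(\cdot,\alpha)$; $\Pr\{E\mid\theta\}$ is the probability of $E$ when the samples have pdf or pmf $f(\cdot,\theta)$. The Berry–Esseen constant $\mathscr{C}$ is a positive absolute constant such that for every random variable $Y$ with $\mathbb{E}[Y]=0$, $\mathbb{E}[Y^2]>0$, $\mathbb{E}[|Y|^3]<\infty$, every $n$ and every $y\in\mathbb{R}$, $|F_n(y)-\Phi(y)|\le\frac{\mathscr{C}}{\sqrt n}\frac{\mathbb{E}[|Y|^3]}{\mathbb{E}^{3/2}[Y^2]}$, where $F_n$ is the cdf of $\sum_{i=1}^nY_i/\sqrt{n\mathbb{E}[Y^2]}$ for i.i.d. copies $Y_i$ of $Y$ and $\Phi$ is the standard normal cdf. *)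

theory Defs
  imports "HOL-Probability.Probability"
begin

definition Phi :: "real \<Rightarrow> real" where
  "Phi y = measure (density lborel (\<lambda>x. ennreal (std_normal_density x))) {..y}"

definition berry_esseen_const :: "real \<Rightarrow> bool" where
  "berry_esseen_const C \<longleftrightarrow> C > 0 \<and>
     (\<forall>(D::real measure) (n::nat) (y::real).
        prob_space D \<and> sets D = sets borel \<and>
        integrable D (\<lambda>t. \<bar>t\<bar> ^ 3) \<and> integrable D (\<lambda>t. t) \<and> integrable D (\<lambda>t. t\<^sup>2) \<and>
        integral\<^sup>L D (\<lambda>t. t) = 0 \<and> integral\<^sup>L D (\<lambda>t. t\<^sup>2) > 0 \<and> n \<ge> 1
        \<longrightarrow>
        \<bar>measure (PiM {..<n} (\<lambda>_. D))
            {\<omega> \<in> space (PiM {..<n} (\<lambda>_. D)).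
               (\<Sum>i<n. \<omega> i) / sqrt (real n * integral\<^sup>L D (\<lambda>t. t\<^sup>2)) \<le> y}
          - Phi y\<bar>
        \<le> C / sqrt (real n) * (integral\<^sup>L D (\<lambda>t. \<bar>t\<bar> ^ 3) /
                                 (integral\<^sup>L D (\<lambda>t. t\<^sup>2)) powr (3/2)))"

definition ef_pdf :: "(real \<Rightarrow> real) \<Rightarrow> (real \<Rightarrow> real) \<Rightarrow> (real \<Rightarrow> real) \<Rightarrow> (real \<Rightarrow> real)
    \<Rightarrow> real \<Rightarrow> real \<Rightarrow> real" where
  "ef_pdf u v \<eta> \<zeta> t x = v x * exp (\<eta> t * u x - \<zeta> t)"

definition ef_dist :: "real measure \<Rightarrow> (real \<Rightarrow> real) \<Rightarrow> (real \<Rightarrow> real) \<Rightarrow> (real \<Rightarrow> real)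
    \<Rightarrow> (real \<Rightarrow> real) \<Rightarrow> real \<Rightarrow> real measure" where
  "ef_dist M u v \<eta> \<zeta> t = density M (\<lambda>x. ennreal (ef_pdf u v \<eta> \<zeta> t x))"

definition ef_mean :: "real measure \<Rightarrow> (real \<Rightarrow> real) \<Rightarrow> (real \<Rightarrow> real) \<Rightarrow> (real \<Rightarrow> real)
    \<Rightarrow> (real \<Rightarrow> real) \<Rightarrow> real \<Rightarrow> real" where
  "ef_mean M u v \<eta> \<zeta> t = integral\<^sup>L (ef_dist M u v \<eta> \<zeta> t) u"

definition ef_sample :: "real measure \<Rightarrow> (real \<Rightarrow> real) \<Rightarrow> (real \<Rightarrow> real) \<Rightarrow> (real \<Rightarrow> real)
    \<Rightarrow> (real \<Rightarrow> real) \<Rightarrow> nat \<Rightarrow> real \<Rightarrow> (nat \<Rightarrow> real) measure" where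
  "ef_sample M u v \<eta> \<zeta> n t = PiM {..<n} (\<lambda>_. ef_dist M u v \<eta> \<zeta> t)"

definition Zbar :: "(real \<Rightarrow> real) \<Rightarrow> nat \<Rightarrow> (nat \<Rightarrow> real) \<Rightarrow> real" where
  "Zbar u n \<omega> = (\<Sum>i<n. u (\<omega> i)) / real n"

definition Pr_ge :: "real measure \<Rightarrow> (real \<Rightarrow> real) \<Rightarrow> (real \<Rightarrow> real) \<Rightarrow> (real \<Rightarrow> real)
    \<Rightarrow> (real \<Rightarrow> real) \<Rightarrow> nat \<Rightarrow> real \<Rightarrow> real \<Rightarrow> real" where
  "Pr_ge M u v \<eta> \<zeta> n t z = measure (ef_sample M u v \<eta> \<zeta> n t)
      {\<omega> \<in> space (ef_sample M u v \<eta> \<zeta> n t). Zbar u n \<omega> \<ge> z}"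

definition Pr_le :: "real measure \<Rightarrow> (real \<Rightarrow> real) \<Rightarrow> (real \<Rightarrow> real) \<Rightarrow> (real \<Rightarrow> real)
    \<Rightarrow> (real \<Rightarrow> real) \<Rightarrow> nat \<Rightarrow> real \<Rightarrow> real \<Rightarrow> real" where
  "Pr_le M u v \<eta> \<zeta> n t z = measure (ef_sample M u v \<eta> \<zeta> n t)
      {\<omega> \<in> space (ef_sample M u v \<eta> \<zeta> n t). Zbar u n \<omega> \<le> z}"

definition ef_rho :: "(real \<Rightarrow> real) \<Rightarrow> (real \<Rightarrow> real) \<Rightarrow> real \<Rightarrow> real \<Rightarrow> real \<Rightarrow> real" where
  "ef_rho \<eta> \<zeta> t z a = (\<eta> t - \<eta> a) * z - \<zeta> t + \<zeta> a"

text \<open>Delta = min{1/2, C/sqrt n * E_a|u(X)-z|^3 / E_a^{3/2}|u(X)-z|^2}, where the ratio is read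
  as +infinity (so Delta = 1/2) when the third moment is infinite or the second moment vanishes.\<close>
definition ef_Delta :: "real measure \<Rightarrow> (real \<Rightarrow> real) \<Rightarrow> (real \<Rightarrow> real) \<Rightarrow> (real \<Rightarrow> real)
    \<Rightarrow> (real \<Rightarrow> real) \<Rightarrow> real \<Rightarrow> nat \<Rightarrow> real \<Rightarrow> real \<Rightarrow> real" where
  "ef_Delta M u v \<eta> \<zeta> C n a z =
     (let P = ef_dist M u v \<eta> \<zeta> a;
          m3 = integral\<^sup>L P (\<lambda>x. \<bar>u x - z\<bar> ^ 3);
          m2 = integral\<^sup>L P (\<lambda>x. \<bar>u x - z\<bar> ^ 2)
      in if integrable P (\<lambda>x. \<bar>u x - z\<bar> ^ 3) \<and> m2 > 0
         then min (1/2) (C / sqrt (real n) * (m3 / m2 powr (3/2)))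
         else 1/2)"

end

theory Submission
  imports Defs
begin

text \<open>
  With \<open>Y = u - z\<close>, the law at \<open>\<theta>\<close> has density \<open>exp (\<rho> - a * Y)\<close>, \<open>a = \<eta> \<alpha> - \<eta> \<theta>\<close>, with respect to
  the law at \<open>\<alpha>\<close>, under which \<open>Y\<close> is centred. If \<open>a \<ge> 0\<close>, the \<open>n\<close>-fold product density is at most
  \<open>exp (n * \<rho>)\<close> on \<open>{Z \<ge> z}\<close>, and Berry-Esseen at \<open>0\<close> bounds the remaining probability. In (I),
  \<open>a < 0\<close> is impossible: tilting by \<open>exp (\<bar>a\<bar> * Y)\<close> strictly increases the mean of a nondegenerate \<open>Y\<close>.

  For the limit it suffices that \<open>Pr {z \<le> Z \<le> z + \<epsilon> | \<alpha>}\<close> decays subexponentially. Only the first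
  moment of \<open>u\<close> is finite, so one passes to a bounded truncation with a slightly positive mean, whose
  density is at most \<open>exp \<delta>\<close>; this costs a factor \<open>exp (\<delta> * n)\<close>, and Hoeffding's inequality applies.
  The lower tails follow by replacing \<open>u, \<eta>, z\<close> with their negatives.
\<close>

section \<open>Densities of finite product measures\<close>

text \<open>On a box both the product density and the indicator factor over the coordinates, so the
  integral becomes the product of the marginal masses; boxes determine a finite product
  measure.\<close>

lemma PiM_density:
  fixes P :: "'a measure" and g :: "'a \<Rightarrow> ennreal"
  assumes "prob_space P" and "prob_space (density P g)"
    and [measurable]: "g \<in> borel_measurable P" and I: "finite I"
  shows "PiM I (\<lambda>_. density P g) = density (PiM I (\<lambda>_. P)) (\<lambda>\<omega>. \<Prod>i\<in>I. g (\<omega> i))"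
proof -
  interpret P: prob_space P by fact
  interpret PP: product_sigma_finite "\<lambda>_::'b. P"
    by standard
  interpret Q: prob_space "density P g" by fact
  interpret QQ: product_sigma_finite "\<lambda>_::'b. density P g"
    by standard
  show ?thesis
  proof (rule QQ.PiM_eqI[OF I, symmetric])
    show "sets (density (PiM I (\<lambda>_. P)) (\<lambda>\<omega>. \<Prod>i\<in>I. g (\<omega> i))) = sets (PiM I (\<lambda>_. density P g))"
      by (simp cong: sets_PiM_cong)
    fix A :: "'b \<Rightarrow> 'a set"
    assume "\<And>i. i \<in> I \<Longrightarrow> A i \<in> sets (density P g)"
    then have A[measurable]: "A i \<in> sets P" if "i \<in> I" for i
      using that by simp
    have "emeasure (density (PiM I (\<lambda>_. P)) (\<lambda>\<omega>. \<Prod>i\<in>I. g (\<omega> i))) (Pi\<^sub>E I A)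
        = (\<integral>\<^sup>+\<omega>. (\<Prod>i\<in>I. g (\<omega> i)) * indicator (Pi\<^sub>E I A) \<omega> \<partial>PiM I (\<lambda>_. P))"
      by (rule emeasure_density) (auto intro!: sets_PiM_I_finite I A)
    also have "\<dots> = (\<integral>\<^sup>+\<omega>. (\<Prod>i\<in>I. g (\<omega> i) * indicator (A i) (\<omega> i)) \<partial>PiM I (\<lambda>_. P))"
    proof (rule nn_integral_cong)
      fix \<omega> assume "\<omega> \<in> space (PiM I (\<lambda>_. P))"
      then have "indicator (Pi\<^sub>E I A) \<omega> = (\<Prod>i\<in>I. indicator (A i) (\<omega> i) :: ennreal)"
        using I by (auto simp: space_PiM PiE_iff indicator_def prod_eq_1_iff[symmetric] intro!: prod_zero)
      then show "(\<Prod>i\<in>I. g (\<omega> i)) * indicator (Pi\<^sub>E I A) \<omega>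
          = (\<Prod>i\<in>I. g (\<omega> i) * indicator (A i) (\<omega> i))"
        by (simp add: prod.distrib)
    qed
    also have "\<dots> = (\<Prod>i\<in>I. \<integral>\<^sup>+x. g x * indicator (A i) x \<partial>P)"
      by (rule PP.product_nn_integral_prod[OF I]) simp
    also have "\<dots> = (\<Prod>i\<in>I. emeasure (density P g) (A i))"
      by (intro prod.cong refl emeasure_density[symmetric]) auto
    finally show "emeasure (density (PiM I (\<lambda>_. P)) (\<lambda>\<omega>. \<Prod>i\<in>I. g (\<omega> i))) (Pi\<^sub>E I A)
        = (\<Prod>i\<in>I. emeasure (density P g) (A i))" .
  qed
qed

lemma emeasure_PiM_density:
  fixes P :: "'a measure" and g :: "'a \<Rightarrow> real"
  assumes "prob_space P" and "prob_space (density P (\<lambda>x. ennreal (g x)))"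
    and [measurable]: "g \<in> borel_measurable P" and g: "\<And>x. 0 \<le> g x" and I: "finite I"
    and A: "A \<in> sets (PiM I (\<lambda>_. P))"
  shows "emeasure (PiM I (\<lambda>_. density P (\<lambda>x. ennreal (g x)))) A
    = (\<integral>\<^sup>+\<omega>. ennreal (\<Prod>i\<in>I. g (\<omega> i)) * indicator A \<omega> \<partial>PiM I (\<lambda>_. P))"
  using A by (simp add: PiM_density[OF assms(1,2) _ I] emeasure_density prod_ennreal g)

text \<open>Change of measure: the new probability of \<open>A\<close> is the integral of the
  product density over \<open>A\<close>, so a pointwise bound there comes out as a factor. The lower
  bound \<open>measure_PiM_density_ge\<close> has the same reason.\<close>

lemma measure_PiM_density_le:
  fixes P :: "'a measure" and g :: "'a \<Rightarrow> real"
  assumes P: "prob_space P" and Q: "prob_space (density P (\<lambda>x. ennreal (g x)))"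
    and g_meas: "g \<in> borel_measurable P" and g: "\<And>x. 0 \<le> g x" and I: "finite I"
    and A: "A \<in> sets (PiM I (\<lambda>_. P))" and le: "\<And>\<omega>. \<omega> \<in> A \<Longrightarrow> (\<Prod>i\<in>I. g (\<omega> i)) \<le> c"
    and c: "0 \<le> c"
  shows "measure (PiM I (\<lambda>_. density P (\<lambda>x. ennreal (g x)))) A \<le> c * measure (PiM I (\<lambda>_. P)) A"
proof -
  interpret PP: prob_space "PiM I (\<lambda>_. P)"
    by (intro prob_space_PiM P)
  interpret QQ: prob_space "PiM I (\<lambda>_. density P (\<lambda>x. ennreal (g x)))"
    by (intro prob_space_PiM Q)
  have "emeasure (PiM I (\<lambda>_. density P (\<lambda>x. ennreal (g x)))) A
      \<le> (\<integral>\<^sup>+\<omega>. ennreal c * indicator A \<omega> \<partial>PiM I (\<lambda>_. P))"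
    unfolding emeasure_PiM_density[OF P Q g_meas g I A]
    by (intro nn_integral_mono) (auto simp: indicator_def le intro!: ennreal_leI)
  also have "\<dots> = ennreal (c * measure (PiM I (\<lambda>_. P)) A)"
    using A c by (simp add: nn_integral_cmult_indicator PP.emeasure_eq_measure ennreal_mult)
  finally show ?thesis
    using c by (simp add: QQ.emeasure_eq_measure)
qed

lemma measure_PiM_density_ge:
  fixes P :: "'a measure" and g :: "'a \<Rightarrow> real"
  assumes P: "prob_space P" and Q: "prob_space (density P (\<lambda>x. ennreal (g x)))"
    and g_meas: "g \<in> borel_measurable P" and g: "\<And>x. 0 \<le> g x" and I: "finite I"
    and A: "A \<in> sets (PiM I (\<lambda>_. P))" and ge: "\<And>\<omega>. \<omega> \<in> A \<Longrightarrow> c \<le> (\<Prod>i\<in>I. g (\<omega> i))"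
    and c: "0 \<le> c"
  shows "c * measure (PiM I (\<lambda>_. P)) A \<le> measure (PiM I (\<lambda>_. density P (\<lambda>x. ennreal (g x)))) A"
proof -
  interpret PP: prob_space "PiM I (\<lambda>_. P)"
    by (intro prob_space_PiM P)
  interpret QQ: prob_space "PiM I (\<lambda>_. density P (\<lambda>x. ennreal (g x)))"
    by (intro prob_space_PiM Q)
  have "ennreal (c * measure (PiM I (\<lambda>_. P)) A) = (\<integral>\<^sup>+\<omega>. ennreal c * indicator A \<omega> \<partial>PiM I (\<lambda>_. P))"
    using A c by (simp add: nn_integral_cmult_indicator PP.emeasure_eq_measure ennreal_mult)
  also have "\<dots> \<le> emeasure (PiM I (\<lambda>_. density P (\<lambda>x. ennreal (g x)))) A"
    unfolding emeasure_PiM_density[OF P Q g_meas g I A]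
    by (intro nn_integral_mono) (auto simp: indicator_def ge intro!: ennreal_leI)
  finally show ?thesis
    using c by (simp add: QQ.emeasure_eq_measure)
qed

section \<open>Subexponential lower bounds for centred sums\<close>

text \<open>Hoeffding's inequality bounds the complementary probability by
  \<open>2 * exp (- m * e\<^sup>2 / (2 * K\<^sup>2))\<close>, which tends to 0. The value
  \<open>1 / 2\<close> is a convenience: later it contributes only \<open>ln 2 / m\<close> to an
  exponential rate.\<close>

lemma measure_sum_concentrated:
  fixes P :: "'a measure" and Y :: "'a \<Rightarrow> real"
  assumes P: "prob_space P" and [measurable]: "Y \<in> borel_measurable P"
    and K: "K > 0" and bounded: "AE x in P. \<bar>Y x\<bar> \<le> K"
    and e: "e > 0"
  shows "eventually (\<lambda>m::nat. 1 / 2 \<le> measure (PiM {..<m} (\<lambda>_. P))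
      {\<omega> \<in> space (PiM {..<m} (\<lambda>_. P)). \<bar>(\<Sum>i<m. Y (\<omega> i)) - real m * integral\<^sup>L P Y\<bar> < real m * e}) sequentially"
proof -
  have lim: "(\<lambda>m::nat. 2 * exp (- (2 * (real m * e)\<^sup>2 / (real m * (2 * K)\<^sup>2)))) \<longlonglongrightarrow> 0"
  proof -
    have "filterlim (\<lambda>m::nat. (e\<^sup>2 / (2 * K\<^sup>2)) * real m) at_top sequentially"
      using e K by (intro filterlim_tendsto_pos_mult_at_top[OF tendsto_const] filterlim_real_sequentially) auto
    then have "(\<lambda>m::nat. exp (- ((e\<^sup>2 / (2 * K\<^sup>2)) * real m))) \<longlonglongrightarrow> 0"
      by (intro filterlim_compose[OF exp_at_bot] filterlim_compose[OF filterlim_uminus_at_bot_at_top])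
    then have "(\<lambda>m::nat. 2 * exp (- ((e\<^sup>2 / (2 * K\<^sup>2)) * real m))) \<longlonglongrightarrow> 2 * 0"
      by (intro tendsto_intros)
    \<comment> \<open>At \<open>m = 0\<close> both sides are 0, because division by 0 yields
      0.\<close>
    moreover have "(e\<^sup>2 / (2 * K\<^sup>2)) * real m = 2 * (real m * e)\<^sup>2 / (real m * (2 * K)\<^sup>2)" for m :: nat
      using K by (cases "m = 0") (auto simp: field_simps power2_eq_square)
    ultimately show ?thesis by simp
  qed
  have ev: "eventually (\<lambda>m::nat. 2 * exp (- (2 * (real m * e)\<^sup>2 / (real m * (2 * K)\<^sup>2))) < 1 / 2) sequentially"
    by (rule order_tendstoD(2)[OF lim]) simp
  show ?thesis
    using ev eventually_gt_at_top[of 0]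
  proof eventually_elim
    case (elim m)
    let ?PP = "PiM {..<m} (\<lambda>_. P)"
    interpret PP: prob_space ?PP by (intro prob_space_PiM P)
    have distr: "distr ?PP borel (\<lambda>\<omega>. Y (\<omega> i)) = distr P borel Y" if "i < m" for i
    proof -
      have "distr ?PP borel (\<lambda>\<omega>. Y (\<omega> i)) = distr (distr ?PP P (\<lambda>\<omega>. \<omega> i)) borel Y"
        using that by (subst distr_distr) (auto simp: comp_def)
      also have "distr ?PP P (\<lambda>\<omega>. \<omega> i) = P"
        using that P by (intro distr_PiM_component) auto
      finally show ?thesis .
    qed
    have expect: "PP.expectation (\<lambda>\<omega>. Y (\<omega> i)) = integral\<^sup>L P Y" if i: "i < m" for i
    proof -
      have [measurable]: "(\<lambda>\<omega>. Y (\<omega> i)) \<in> borel_measurable ?PP" using i by simp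
      have "PP.expectation (\<lambda>\<omega>. Y (\<omega> i)) = integral\<^sup>L (distr ?PP borel (\<lambda>\<omega>. Y (\<omega> i))) (\<lambda>y. y)"
        by (simp add: integral_distr)
      also have "\<dots> = integral\<^sup>L P Y"
        unfolding distr[OF i] by (simp add: integral_distr)
      finally show ?thesis .
    qed
    \<comment> \<open>Independence is read off from the joint law: the image of a product measure
      under a coordinatewise map is the product of the images.\<close>
    have indep: "PP.indep_vars (\<lambda>_. borel) (\<lambda>i \<omega>. Y (\<omega> i)) {..<m}"
    proof (subst PP.indep_vars_iff_distr_eq_PiM')
      show "{..<m} \<noteq> {}" using elim by auto
      show "(\<lambda>\<omega>. Y (\<omega> i)) \<in> borel_measurable ?PP" if "i \<in> {..<m}" for i
        using that by measurable
      have "distr ?PP (PiM {..<m} (\<lambda>_. borel)) (\<lambda>\<omega>. \<lambda>i\<in>{..<m}. Y (\<omega> i))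
          = distr ?PP (PiM {..<m} (\<lambda>_. distr P borel Y)) (compose {..<m} Y)"
        by (intro distr_cong sets_PiM_cong) (auto simp: compose_def)
      also have "\<dots> = PiM {..<m} (\<lambda>i. distr P (distr P borel Y) Y)"
        using P by (intro distr_PiM_finite_prob_space') (auto intro: prob_space.prob_space_distr)
      also have "\<dots> = PiM {..<m} (\<lambda>i. distr ?PP borel (\<lambda>\<omega>. Y (\<omega> i)))"
        by (intro PiM_cong) (auto simp: distr intro: distr_cong)
      finally show "distr ?PP (PiM {..<m} (\<lambda>_. borel)) (\<lambda>\<omega>. \<lambda>i\<in>{..<m}. Y (\<omega> i))
          = PiM {..<m} (\<lambda>i. distr ?PP borel (\<lambda>\<omega>. Y (\<omega> i)))" .
    qed
    interpret H: Hoeffding_ineq ?PP "{..<m}" "\<lambda>i \<omega>. Y (\<omega> i)" "\<lambda>_. - K" "\<lambda>_. K" "real m * integral\<^sup>L P Y"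
    proof unfold_locales
      fix i assume i: "i \<in> {..<m}"
      have "AE x in ?PP. \<bar>Y (x i)\<bar> \<le> K"
        using P i bounded by (intro AE_PiM_component) auto
      then show "AE x in ?PP. Y (x i) \<in> {- K..K}"
        by eventually_elim auto
    next
      show "real m * integral\<^sup>L P Y \<equiv> (\<Sum>i\<in>{..<m}. PP.expectation (\<lambda>\<omega>. Y (\<omega> i)))"
        using expect by (intro eq_reflection) simp
    qed (use indep in auto)
    have "PP.prob {\<omega> \<in> space ?PP. real m * e \<le> \<bar>(\<Sum>i<m. Y (\<omega> i)) - real m * integral\<^sup>L P Y\<bar>}
        \<le> 2 * exp (- 2 * (real m * e)\<^sup>2 / (\<Sum>i<m. (K - - K)\<^sup>2))"
      using e K elim by (intro H.Hoeffding_ineq_abs_ge) auto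
    also have "\<dots> < 1 / 2"
      using elim by simp
    finally have less: "PP.prob {\<omega> \<in> space ?PP. real m * e \<le> \<bar>(\<Sum>i<m. Y (\<omega> i)) - real m * integral\<^sup>L P Y\<bar>} < 1 / 2" .
    have "{\<omega> \<in> space ?PP. \<bar>(\<Sum>i<m. Y (\<omega> i)) - real m * integral\<^sup>L P Y\<bar> < real m * e}
        = space ?PP - {\<omega> \<in> space ?PP. real m * e \<le> \<bar>(\<Sum>i<m. Y (\<omega> i)) - real m * integral\<^sup>L P Y\<bar>}"
      by auto
    then show ?case
      using less by (simp add: PP.prob_compl)
  qed
qed

text \<open>A plain truncation of \<open>Y\<close> could push the mean to either side of 0. The
  positive values are therefore weighted slightly more before truncating; dominated convergence
  carries the strict inequalities over to a large truncation level. The bound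
  \<open>exp \<delta>\<close> on the density is what keeps the cost of the change of law
  small.\<close>

lemma exists_bounded_tilt_small_positive_mean:
  fixes P :: "'a measure" and Y :: "'a \<Rightarrow> real"
  assumes P: "prob_space P" and Y: "integrable P Y" and mean: "integral\<^sup>L P Y = 0"
    and nondeg: "\<not> (AE x in P. Y x = 0)" and \<epsilon>: "\<epsilon> > 0" and \<delta>: "\<delta> > 0"
  obtains h K where "h \<in> borel_measurable P" "\<And>x. 0 \<le> h x" "\<And>x. h x \<le> exp \<delta>"
    "prob_space (density P (\<lambda>x. ennreal (h x)))" "K > 0" "\<And>x. \<bar>Y x\<bar> > K \<Longrightarrow> h x = 0"
    "0 < (\<integral>x. h x * Y x \<partial>P)" "(\<integral>x. h x * Y x \<partial>P) < \<epsilon>"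
proof -
  interpret prob_space P by fact
  have [measurable]: "Y \<in> borel_measurable P" using Y by simp
  define p where "p = (\<integral>x. max 0 (Y x) \<partial>P)"
  have int_pos: "integrable P (\<lambda>x. max 0 (Y x))"
    using Y by simp
  \<comment> \<open>If the positive part vanished almost everywhere, \<open>- Y\<close> would be
    nonnegative with mean 0, hence 0 almost everywhere, against \<open>nondeg\<close>.\<close>
  have "p \<noteq> 0"
  proof
    assume "p = 0"
    then have pos0: "AE x in P. max 0 (Y x) = 0"
      unfolding p_def using integral_nonneg_eq_0_iff_AE[OF int_pos] by simp
    then have le0: "AE x in P. 0 \<le> - Y x" by eventually_elim auto
    have "AE x in P. - Y x = 0"
      using integral_nonneg_eq_0_iff_AE[OF _ le0] Y mean by simp
    then show False using nondeg by simp
  qed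
  moreover have "p \<ge> 0" unfolding p_def by simp
  ultimately have p: "p > 0" by simp
  have "exp \<delta> > 1" using \<delta> by simp
  then obtain \<tau> where \<tau>: "\<tau> > 0" "1 + \<tau> < exp \<delta>" "\<tau> * p < \<epsilon>"
  proof -
    \<comment> \<open>Half of each admissible range, so that both bounds hold strictly and survive
      the passage from the limit to a finite truncation level.\<close>
    define t where "t = min ((exp \<delta> - 1) / 2) (\<epsilon> / (2 * p))"
    have t: "t \<le> (exp \<delta> - 1) / 2" "t \<le> \<epsilon> / (2 * p)" "t > 0"
      unfolding t_def by (rule min.cobounded1, rule min.cobounded2) (use \<open>exp \<delta> > 1\<close> p \<epsilon> in simp)
    have "t * p \<le> \<epsilon> / (2 * p) * p" using p t by (intro mult_right_mono) auto
    also have "\<dots> < \<epsilon>" using p \<epsilon> by simp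
    finally have "t * p < \<epsilon>" .
    moreover have "1 + t < exp \<delta>" using \<open>exp \<delta> > 1\<close> t by (simp add: field_simps)
    ultimately show thesis using that t by blast
  qed
  \<comment> \<open>The extra weight \<open>\<tau>\<close> on \<open>{Y > 0}\<close> makes the limiting mean \<open>\<tau> * p\<close> strictly positive; the
      truncation \<open>w j\<close> of this weight then keeps it positive for large \<open>j\<close>.\<close>
  define s where "s x = 1 + \<tau> * indicator {0<..} (Y x)" for x
  define w where "w j x = (s x * indicator {..real j} \<bar>Y x\<bar> :: real)" for j x
  define c where "c j = (\<integral>x. w j x \<partial>P)" for j
  have [measurable]: "s \<in> borel_measurable P" unfolding s_def by measurable
  have [measurable]: "w j \<in> borel_measurable P" for j unfolding w_def by measurable
  have s: "1 \<le> s x" "s x \<le> 1 + \<tau>" "\<bar>s x\<bar> \<le> 1 + \<tau>" for x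
    using \<tau> by (auto simp: s_def indicator_def)
  have w: "0 \<le> w j x" "w j x \<le> 1 + \<tau>" for j x
    using s[of x] \<tau> by (auto simp: w_def indicator_def)
  have w_lim: "(\<lambda>j. w j x) \<longlonglongrightarrow> s x" for x
  proof (rule tendsto_eventually)
    show "\<forall>\<^sub>F j in sequentially. w j x = s x"
      using eventually_ge_at_top[of "nat \<lceil>\<bar>Y x\<bar>\<rceil>"]
      by eventually_elim (auto simp: w_def nat_le_iff ceiling_le_iff)
  qed
  have int_s: "integrable P s"
    by (rule integrable_const_bound[of _ "1 + \<tau>"]) (use s in auto)
  have c_lim: "c \<longlonglongrightarrow> integral\<^sup>L P s"
    unfolding c_def
    by (rule integral_dominated_convergence[where w="\<lambda>_. 1 + \<tau>"]) (use w w_lim in auto)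
  have lim: "(\<lambda>j. \<integral>x. w j x * Y x \<partial>P) \<longlonglongrightarrow> (\<integral>x. s x * Y x \<partial>P)"
  proof (rule integral_dominated_convergence[where w="\<lambda>x. (1 + \<tau>) * \<bar>Y x\<bar>"])
    show "AE x in P. (\<lambda>j. w j x * Y x) \<longlonglongrightarrow> s x * Y x"
      by (intro AE_I2 tendsto_intros w_lim)
    show "AE x in P. norm (w j x * Y x) \<le> (1 + \<tau>) * \<bar>Y x\<bar>" for j
      using w by (auto simp: abs_mult intro!: mult_right_mono)
  qed (use Y in auto)
  have "(\<integral>x. s x * Y x \<partial>P) = (\<integral>x. Y x + \<tau> * max 0 (Y x) \<partial>P)"
    by (intro Bochner_Integration.integral_cong) (auto simp: s_def indicator_def max_def algebra_simps)
  also have "\<dots> = \<tau> * p"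
    using Y int_pos by (simp add: p_def mean)
  finally have sY: "(\<integral>x. s x * Y x \<partial>P) = \<tau> * p" .
  \<comment> \<open>The weights \<open>s\<close> are at least 1, so the limiting normalisation is
    too; dividing by it cannot spoil the upper bounds \<epsilon> on the mean and
    \<open>exp \<delta>\<close> on the density.\<close>
  have "(\<integral>x. 1 \<partial>P) \<le> integral\<^sup>L P s"
    using s int_s by (intro integral_mono) auto
  then have c1: "1 \<le> integral\<^sup>L P s" by (simp add: prob_space)
  have ev1: "eventually (\<lambda>j. 0 < (\<integral>x. w j x * Y x \<partial>P)) sequentially"
    by (rule order_tendstoD(1)[OF lim]) (use \<tau> p sY in auto)
  \<comment> \<open>This condition and the next are stated without dividing by \<open>c j\<close>,
    whose positivity is only derived once \<open>j\<close> is chosen.\<close>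
  have ev2: "eventually (\<lambda>j. 0 < \<epsilon> * c j - (\<integral>x. w j x * Y x \<partial>P)) sequentially"
  proof (rule order_tendstoD(1)[OF tendsto_diff[OF tendsto_mult[OF tendsto_const c_lim] lim]])
    have "\<epsilon> * 1 \<le> \<epsilon> * integral\<^sup>L P s" using c1 \<epsilon> by (intro mult_left_mono) auto
    then show "0 < \<epsilon> * integral\<^sup>L P s - (\<integral>x. s x * Y x \<partial>P)" using \<tau> sY by simp
  qed
  have ev3: "eventually (\<lambda>j. 1 + \<tau> < c j * exp \<delta>) sequentially"
  proof (rule order_tendstoD(1)[OF tendsto_mult[OF c_lim tendsto_const]])
    have "1 * exp \<delta> \<le> integral\<^sup>L P s * exp \<delta>" using c1 by (intro mult_right_mono) auto
    then show "1 + \<tau> < integral\<^sup>L P s * exp \<delta>" using \<tau> by linarith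
  qed
  obtain j :: nat where j: "0 < (\<integral>x. w j x * Y x \<partial>P)" "0 < \<epsilon> * c j - (\<integral>x. w j x * Y x \<partial>P)"
      "1 + \<tau> < c j * exp \<delta>" "j > 0"
    using eventually_happens[OF eventually_conj[OF ev1 eventually_conj[OF ev2
          eventually_conj[OF ev3 eventually_gt_at_top[of 0]]]]] by auto
  have c: "c j > 0"
    using j(3) \<tau> by (metis add_pos_pos exp_gt_zero less_trans zero_less_mult_pos2 zero_less_one)
  have int_w: "integrable P (w j)"
    by (rule integrable_const_bound[of _ "1 + \<tau>"]) (use w in auto)
  show thesis
  proof (rule that[of "\<lambda>x. w j x / c j" "real j"])
    show "prob_space (density P (\<lambda>x. ennreal (w j x / c j)))"
    proof (rule prob_spaceI)
      have "emeasure (density P (\<lambda>x. ennreal (w j x / c j))) (space P) = (\<integral>\<^sup>+x. ennreal (w j x / c j) \<partial>P)"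
        by (subst emeasure_density) (auto intro!: nn_integral_cong)
      also have "\<dots> = ennreal (\<integral>x. w j x / c j \<partial>P)"
        using int_w w c by (intro nn_integral_eq_integral) auto
      also have "\<dots> = 1" using c by (simp add: c_def)
      finally show "emeasure (density P (\<lambda>x. ennreal (w j x / c j)))
          (space (density P (\<lambda>x. ennreal (w j x / c j)))) = 1" by simp
    qed
    show "w j x / c j \<le> exp \<delta>" for x
      using w(2)[of j x] j(3) c by (simp add: pos_divide_le_eq mult.commute)
    show "0 < (\<integral>x. w j x / c j * Y x \<partial>P)" "(\<integral>x. w j x / c j * Y x \<partial>P) < \<epsilon>"
      using j c by (simp_all add: pos_divide_less_eq)
    show "w j x / c j = 0" if "\<bar>Y x\<bar> > real j" for x
      using that by (simp add: w_def)
  qed (use w c j in auto)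
qed

text \<open>Under the bounded law with mean inside \<open>(0, \<epsilon>)\<close> the event is
  typical and has probability at least \<open>1 / 2\<close>. The \<open>m\<close>-fold density of
  that law is at most \<open>exp (\<delta> * m)\<close>, so returning to \<open>P\<close> loses at
  most this factor.\<close>

lemma mean_zero_sum_small_positive_subexponential:
  fixes P :: "'a measure" and Y :: "'a \<Rightarrow> real"
  assumes P: "prob_space P" and Y: "integrable P Y" and mean: "integral\<^sup>L P Y = 0"
    and nondeg: "\<not> (AE x in P. Y x = 0)" and \<epsilon>: "\<epsilon> > 0" and \<delta>: "\<delta> > 0"
  shows "eventually (\<lambda>m::nat. exp (- \<delta> * real m) / 2 \<le> measure (PiM {..<m} (\<lambda>_. P))
      {\<omega> \<in> space (PiM {..<m} (\<lambda>_. P)). 0 \<le> (\<Sum>i<m. Y (\<omega> i)) \<and> (\<Sum>i<m. Y (\<omega> i)) \<le> real m * \<epsilon>}) sequentially"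
proof -
  obtain h K where [measurable]: "h \<in> borel_measurable P" and h: "\<And>x. 0 \<le> h x" "\<And>x. h x \<le> exp \<delta>"
    and Q: "prob_space (density P (\<lambda>x. ennreal (h x)))" and K: "K > 0" "\<And>x. \<bar>Y x\<bar> > K \<Longrightarrow> h x = 0"
    and hY: "0 < (\<integral>x. h x * Y x \<partial>P)" "(\<integral>x. h x * Y x \<partial>P) < \<epsilon>"
    by (rule exists_bounded_tilt_small_positive_mean[OF assms]) (rule that; assumption)
  have [measurable]: "Y \<in> borel_measurable P" using Y by simp
  let ?Q = "density P (\<lambda>x. ennreal (h x))"
  \<comment> \<open>The distance from the new mean to the nearer end of
    \<open>(0, \<epsilon>)\<close>: a deviation below \<open>m * e\<close> keeps the sum between 0
    and \<open>m * \<epsilon>\<close>.\<close>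
  define e where "e = min (integral\<^sup>L ?Q Y) (\<epsilon> - integral\<^sup>L ?Q Y)"
  have mean_Q: "integral\<^sup>L ?Q Y = (\<integral>x. h x * Y x \<partial>P)"
    using h by (subst integral_density) auto
  have e: "e > 0" using hY mean_Q by (simp add: e_def)
  have "AE x in ?Q. \<bar>Y x\<bar> \<le> K"
    using K(2) by (subst AE_density) (auto intro!: AE_I2 simp: linorder_not_less[symmetric])
  then have "eventually (\<lambda>m::nat. 1 / 2 \<le> measure (PiM {..<m} (\<lambda>_. ?Q))
      {\<omega> \<in> space (PiM {..<m} (\<lambda>_. ?Q)). \<bar>(\<Sum>i<m. Y (\<omega> i)) - real m * integral\<^sup>L ?Q Y\<bar> < real m * e}) sequentially"
    using Q K(1) e by (intro measure_sum_concentrated) auto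
  then show ?thesis
  proof eventually_elim
    case (elim m)
    let ?PP = "PiM {..<m} (\<lambda>_. P)" and ?QQ = "PiM {..<m} (\<lambda>_. ?Q)"
    let ?A = "{\<omega> \<in> space ?PP. 0 \<le> (\<Sum>i<m. Y (\<omega> i)) \<and> (\<Sum>i<m. Y (\<omega> i)) \<le> real m * \<epsilon>}"
    interpret QQ: prob_space ?QQ by (intro prob_space_PiM Q)
    have space_eq: "space ?QQ = space ?PP" by (simp add: space_PiM)
    have sets_eq: "sets ?QQ = sets ?PP" by (intro sets_PiM_cong) auto
    have A: "?A \<in> sets ?PP" by measurable
    have "1 / 2 \<le> measure ?QQ {\<omega> \<in> space ?QQ. \<bar>(\<Sum>i<m. Y (\<omega> i)) - real m * integral\<^sup>L ?Q Y\<bar> < real m * e}"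
      by (rule elim)
    also have "\<dots> \<le> measure ?QQ ?A"
    proof (rule QQ.finite_measure_mono)
      have "real m * e \<le> real m * integral\<^sup>L ?Q Y" "real m * e \<le> real m * (\<epsilon> - integral\<^sup>L ?Q Y)"
        unfolding e_def by (intro mult_left_mono; simp)+
      then show "{\<omega> \<in> space ?QQ. \<bar>(\<Sum>i<m. Y (\<omega> i)) - real m * integral\<^sup>L ?Q Y\<bar> < real m * e} \<subseteq> ?A"
        unfolding space_eq by (auto simp: right_diff_distrib)
    qed (use A sets_eq in simp)
    also have "\<dots> \<le> exp (\<delta> * real m) * measure ?PP ?A"
    proof (rule measure_PiM_density_le[OF P Q _ h(1) _ A])
      fix \<omega>
      have "(\<Prod>i<m. h (\<omega> i)) \<le> (\<Prod>i<m. exp \<delta>)"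
        using h by (intro prod_mono) auto
      also have "\<dots> = exp (\<delta> * real m)" by (simp add: exp_of_nat2_mult[symmetric])
      finally show "(\<Prod>i<m. h (\<omega> i)) \<le> exp (\<delta> * real m)" .
    qed auto
    finally show ?case by (simp add: exp_minus field_simps)
  qed
qed

section \<open>Tail probabilities under exponential tilts\<close>

lemma prod_exp_affine:
  fixes Y :: "'a \<Rightarrow> real" and \<omega> :: "nat \<Rightarrow> 'a"
  shows "(\<Prod>i<m. exp (r - a * Y (\<omega> i))) = exp (real m * r - a * (\<Sum>i<m. Y (\<omega> i)))"
  by (simp add: exp_sum[symmetric] sum_subtractf sum_distrib_left)

text \<open>For \<open>a < 0\<close> the function \<open>(exp (r - a * Y) - exp r) * Y\<close> is
  nonnegative and vanishes only where \<open>Y\<close> does. The two mean conditions make its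
  integral at most 0, which forces \<open>Y = 0\<close> almost everywhere. This turns an ordering of
  means into an ordering of natural parameters.\<close>

lemma exp_tilt_nonneg_rate:
  fixes P :: "'a measure" and Y :: "'a \<Rightarrow> real"
  assumes Y: "integrable P Y" and mean: "integral\<^sup>L P Y = 0" and nondeg: "\<not> (AE x in P. Y x = 0)"
    and int: "integrable P (\<lambda>x. exp (r - a * Y x) * Y x)"
    and le: "(\<integral>x. exp (r - a * Y x) * Y x \<partial>P) \<le> 0"
  shows "0 \<le> a"
proof (rule ccontr)
  assume "\<not> 0 \<le> a"
  then have a: "a < 0" by simp
  let ?f = "\<lambda>x. exp (r - a * Y x) * Y x - exp r * Y x"
  have pos: "0 \<le> (exp (r - a * y) - exp r) * y" for y
    using a by (cases "0 \<le> y") (auto simp: zero_le_mult_iff mult_nonpos_nonneg mult_nonpos_nonpos)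
  have f_int: "integrable P ?f" using int Y by simp
  have "integral\<^sup>L P ?f \<le> 0" using le int Y mean by simp
  moreover have f_nonneg: "0 \<le> ?f x" for x using pos[of "Y x"] by (simp add: left_diff_distrib)
  then have "0 \<le> integral\<^sup>L P ?f" by (intro Bochner_Integration.integral_nonneg) auto
  ultimately have "integral\<^sup>L P ?f = 0" by linarith
  then have "AE x in P. ?f x = 0"
    using integral_nonneg_eq_0_iff_AE[OF f_int] f_nonneg by simp
  then have "AE x in P. Y x = 0"
    by eventually_elim (use a in auto)
  then show False using nondeg by simp
qed

text \<open>The product density is \<open>exp (m * r - a * S)\<close> with \<open>S\<close> the sum,
  hence at most \<open>exp (m * r)\<close> where \<open>S\<close> is nonnegative.\<close>

lemma exp_tilt_upper_tail_le:
  fixes P :: "'a measure" and Y :: "'a \<Rightarrow> real"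
  assumes P: "prob_space P" and Q: "prob_space (density P (\<lambda>x. ennreal (exp (r - a * Y x))))"
    and [measurable]: "Y \<in> borel_measurable P" and a: "0 \<le> a"
  shows "measure (PiM {..<m} (\<lambda>_. density P (\<lambda>x. ennreal (exp (r - a * Y x)))))
        {\<omega> \<in> space (PiM {..<m} (\<lambda>_. P)). 0 \<le> (\<Sum>i<m. Y (\<omega> i))}
      \<le> exp (real m * r) * measure (PiM {..<m} (\<lambda>_. P))
        {\<omega> \<in> space (PiM {..<m} (\<lambda>_. P)). 0 \<le> (\<Sum>i<m. Y (\<omega> i))}"
  using a by (intro measure_PiM_density_le[OF P Q]) (auto simp: prod_exp_affine)

text \<open>The upper bound is the preceding lemma. For the lower bound the event is shrunk to sums
  in \<open>[0, m * \<epsilon>]\<close>: there the product density is at least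
  \<open>exp (m * (r - a * \<epsilon>))\<close>, and the untilted probability decays
  subexponentially.\<close>

lemma exp_tilt_upper_tail_log_limit:
  fixes P :: "'a measure" and Y :: "'a \<Rightarrow> real"
  assumes P: "prob_space P" and Q: "prob_space (density P (\<lambda>x. ennreal (exp (r - a * Y x))))"
    and Y: "integrable P Y" and mean: "integral\<^sup>L P Y = 0" and nondeg: "\<not> (AE x in P. Y x = 0)"
    and a: "0 \<le> a"
  shows "(\<lambda>m. ln (measure (PiM {..<m} (\<lambda>_. density P (\<lambda>x. ennreal (exp (r - a * Y x)))))
        {\<omega> \<in> space (PiM {..<m} (\<lambda>_. P)). 0 \<le> (\<Sum>i<m. Y (\<omega> i))}) / real m) \<longlonglongrightarrow> r"
    (is "(\<lambda>m. ln (?q m) / real m) \<longlonglongrightarrow> r")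
proof (rule LIMSEQ_I)
  fix \<gamma> :: real assume \<gamma>: "0 < \<gamma>"
  let ?Q = "density P (\<lambda>x. ennreal (exp (r - a * Y x)))"
  have [measurable]: "Y \<in> borel_measurable P" using Y by simp
  \<comment> \<open>The rate has three errors, \<open>a * \<epsilon>\<close>, the subexponential
    exponent and \<open>ln 2 / m\<close>, each allotted \<open>\<gamma> / 3\<close>. The summand 1
    keeps the quotient meaningful for \<open>a = 0\<close>.\<close>
  define \<epsilon> where "\<epsilon> = \<gamma> / (3 * (a + 1))"
  have \<epsilon>: "\<epsilon> > 0" using \<gamma> a by (simp add: \<epsilon>_def)
  have "a * \<epsilon> \<le> (a + 1) * \<epsilon>" using \<epsilon> by (intro mult_right_mono) auto
  also have "\<dots> = \<gamma> / 3" using a by (simp add: \<epsilon>_def field_simps)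
  finally have a\<epsilon>: "a * \<epsilon> \<le> \<gamma> / 3" .
  have "(\<lambda>m. ln 2 / real m) \<longlonglongrightarrow> 0"
    by (intro lim_const_over_n)
  then have ev: "eventually (\<lambda>m. ln 2 / real m < \<gamma> / 3) sequentially"
    by (rule order_tendstoD(2)) (use \<gamma> in simp)
  have "eventually (\<lambda>m. norm (ln (?q m) / real m - r) < \<gamma>) sequentially"
    using mean_zero_sum_small_positive_subexponential[OF P Y mean nondeg \<epsilon>, of "\<gamma> / 3"]
  proof (rule eventually_elim2)
    show "eventually (\<lambda>m. ln 2 / real m < \<gamma> / 3 \<and> 0 < m) sequentially"
      using ev eventually_gt_at_top[of 0] by eventually_elim simp
  next
    fix m :: nat
    let ?PP = "PiM {..<m} (\<lambda>_. P)" and ?QQ = "PiM {..<m} (\<lambda>_. ?Q)"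
    let ?A = "{\<omega> \<in> space ?PP. 0 \<le> (\<Sum>i<m. Y (\<omega> i)) \<and> (\<Sum>i<m. Y (\<omega> i)) \<le> real m * \<epsilon>}"
    let ?B = "{\<omega> \<in> space ?PP. 0 \<le> (\<Sum>i<m. Y (\<omega> i))}"
    assume low: "exp (- (\<gamma> / 3) * real m) / 2 \<le> measure ?PP ?A" and m: "ln 2 / real m < \<gamma> / 3 \<and> 0 < m"
    interpret PP: prob_space ?PP by (intro prob_space_PiM P)
    interpret QQ: prob_space ?QQ by (intro prob_space_PiM Q)
    have sets_eq: "sets ?QQ = sets ?PP" by (intro sets_PiM_cong) auto
    have upper: "?q m \<le> exp (real m * r)"
    proof -
      have "?q m \<le> exp (real m * r) * measure ?PP ?B"
        by (rule exp_tilt_upper_tail_le[OF P Q _ a]) simp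
      also have "\<dots> \<le> exp (real m * r) * 1"
        by (intro mult_left_mono PP.prob_le_1) auto
      finally show ?thesis by simp
    qed
    have "exp (real m * (r - a * \<epsilon>)) * (exp (- (\<gamma> / 3) * real m) / 2)
        \<le> exp (real m * (r - a * \<epsilon>)) * measure ?PP ?A"
      using low by (intro mult_left_mono) auto
    also have "\<dots> \<le> measure ?QQ ?A"
    proof (rule measure_PiM_density_ge[OF P Q])
      fix \<omega> assume "\<omega> \<in> ?A"
      then have "a * (\<Sum>i<m. Y (\<omega> i)) \<le> a * (real m * \<epsilon>)"
        using a by (intro mult_left_mono) auto
      then show "exp (real m * (r - a * \<epsilon>)) \<le> (\<Prod>i\<in>{..<m}. exp (r - a * Y (\<omega> i)))"
        by (simp add: prod_exp_affine algebra_simps)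
    qed auto
    also have "\<dots> \<le> ?q m"
      by (rule QQ.finite_measure_mono) (auto simp: sets_eq)
    finally have lower: "exp (real m * (r - a * \<epsilon>)) * (exp (- (\<gamma> / 3) * real m) / 2) \<le> ?q m" .
    \<comment> \<open>The lower bound also gives the positivity that both logarithmic estimates rest
      on.\<close>
    then have q_pos: "0 < ?q m"
      by (rule less_le_trans[rotated]) simp
    have "ln (?q m) \<le> real m * r"
      using ln_mono[OF upper q_pos] by simp
    then have 1: "ln (?q m) / real m \<le> r"
      using m by (simp add: field_simps)
    have split: "real m * (r - a * \<epsilon> - \<gamma> / 3) = real m * (r - a * \<epsilon>) + - (\<gamma> / 3) * real m"
      by (simp add: algebra_simps)
    have "exp (real m * (r - a * \<epsilon> - \<gamma> / 3) - ln 2)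
        = exp (real m * (r - a * \<epsilon>)) * (exp (- (\<gamma> / 3) * real m) / 2)"
      unfolding split by (simp only: exp_diff exp_add) simp
    then have "exp (real m * (r - a * \<epsilon> - \<gamma> / 3) - ln 2) \<le> ?q m"
      using lower by (simp only:)
    then have "real m * (r - a * \<epsilon> - \<gamma> / 3) - ln 2 \<le> ln (?q m)"
      using q_pos by (simp add: ln_ge_iff)
    then have "(real m * (r - a * \<epsilon> - \<gamma> / 3) - ln 2) / real m \<le> ln (?q m) / real m"
      by (rule divide_right_mono) simp
    then have "r - a * \<epsilon> - \<gamma> / 3 - ln 2 / real m \<le> ln (?q m) / real m"
      using m by (simp add: diff_divide_distrib)
    then have "\<bar>ln (?q m) / real m - r\<bar> < \<gamma>"
      using 1 a\<epsilon> m \<gamma> by linarith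
    then show "norm (ln (?q m) / real m - r) < \<gamma>" by simp
  qed (use \<gamma> in simp)
  then show "\<exists>no. \<forall>m\<ge>no. norm (ln (?q m) / real m - r) < \<gamma>"
    by (simp add: eventually_sequentially)
qed

section \<open>The Berry-Esseen bound at the mean\<close>

text \<open>The reflection at 0 preserves the normal density, so both closed half-lines have equal
  mass; they overlap only in the null set \<open>{0}\<close>.\<close>

lemma Phi_0: "Phi 0 = 1 / 2"
proof -
  define N where "N = density lborel (\<lambda>x. ennreal (std_normal_density x))"
  interpret N: prob_space N
    unfolding N_def by (rule prob_space_normal_density) simp
  have [simp]: "sets N = sets borel" "space N = UNIV" by (simp_all add: N_def)
  have "emeasure N {..0} = (\<integral>\<^sup>+x. ennreal (std_normal_density x) * indicator {..0} x \<partial>lborel)"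
    unfolding N_def by (rule emeasure_density) auto
  also have "\<dots> = (\<integral>\<^sup>+x. ennreal (std_normal_density x) * indicator {0..} x \<partial>lborel)"
    by (subst nn_integral_real_affine[where c="-1" and t=0])
       (auto intro!: nn_integral_cong simp: normal_density_def indicator_def)
  also have "\<dots> = emeasure N {0..}"
    unfolding N_def by (rule emeasure_density[symmetric]) auto
  finally have sym: "measure N {..0} = measure N {0..}"
    by (simp add: measure_def)
  have "AE x in lborel. x \<noteq> (0::real)"
    by (rule AE_lborel_singleton)
  then have "AE x in N. x \<notin> {0}"
    unfolding N_def by (subst AE_density) auto
  then have "measure N {0} = 0"
    by (subst N.prob_eq_0) auto
  moreover have "measure N ({..0} \<union> {0<..}) = measure N {..0} + measure N {0<..}"
    by (intro N.finite_measure_Union) auto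
  moreover have "measure N ({0} \<union> {0<..}) = measure N {0} + measure N {0<..}"
    by (intro N.finite_measure_Union) auto
  moreover have "{..0} \<union> {0<..} = (UNIV :: real set)" "{0} \<union> {0<..} = {0::real..}" by auto
  ultimately show ?thesis
    using sym N.prob_space unfolding Phi_def N_def[symmetric] by simp
qed

text \<open>The constant is specified through laws on the real line, so the law of a random variable
  on a general space is inserted. At the point 0 the normalisation of the sum is irrelevant and
  \<open>Phi\<close> equals \<open>1 / 2\<close>.\<close>

lemma berry_esseen_upper_tail:
  fixes P :: "'a measure" and Y :: "'a \<Rightarrow> real"
  assumes BE: "berry_esseen_const C" and P: "prob_space P" and n: "1 \<le> n"
    and [measurable]: "Y \<in> borel_measurable P" and Y: "integrable P Y" and mean: "integral\<^sup>L P Y = 0"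
    and Y3: "integrable P (\<lambda>x. \<bar>Y x\<bar> ^ 3)" and var: "0 < (\<integral>x. (Y x)\<^sup>2 \<partial>P)"
  shows "measure (PiM {..<n} (\<lambda>_. P)) {\<omega> \<in> space (PiM {..<n} (\<lambda>_. P)). 0 \<le> (\<Sum>i<n. Y (\<omega> i))}
    \<le> 1 / 2 + C / sqrt (real n) * ((\<integral>x. \<bar>Y x\<bar> ^ 3 \<partial>P) / (\<integral>x. (Y x)\<^sup>2 \<partial>P) powr (3 / 2))"
proof -
  interpret prob_space P by fact
  \<comment> \<open>Applying the bound to \<open>- Y\<close> turns the closed upper tail into a value of the cdf, so an atom
      at \<open>0\<close> does no harm.\<close>
  define D where "D = distr P borel (\<lambda>x. - Y x)"
  have D: "prob_space D" "sets D = sets borel"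
    unfolding D_def by (auto intro: prob_space_distr)
  \<comment> \<open>A nonintegrable function has Bochner integral 0, so the positive second moment
    already gives square integrability.\<close>
  have Y2: "integrable P (\<lambda>x. (Y x)\<^sup>2)"
    using var not_integrable_integral_eq by fastforce
  let ?PP = "PiM {..<n} (\<lambda>_. P)" and ?DD = "PiM {..<n} (\<lambda>_. D)"
  let ?E = "{\<omega> \<in> space ?DD. (\<Sum>i<n. \<omega> i) / sqrt (real n * integral\<^sup>L D (\<lambda>t. t\<^sup>2)) \<le> 0}"
  have moments: "integral\<^sup>L D (\<lambda>t. t) = 0" "integral\<^sup>L D (\<lambda>t. t\<^sup>2) = (\<integral>x. (Y x)\<^sup>2 \<partial>P)"
      "integral\<^sup>L D (\<lambda>t. \<bar>t\<bar> ^ 3) = (\<integral>x. \<bar>Y x\<bar> ^ 3 \<partial>P)"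
    unfolding D_def using mean by (simp_all add: integral_distr)
  have ints: "integrable D (\<lambda>t. t)" "integrable D (\<lambda>t. t\<^sup>2)" "integrable D (\<lambda>t. \<bar>t\<bar> ^ 3)"
    unfolding D_def using Y Y2 Y3 by (simp_all add: integrable_distr_eq)
  have bound: "\<bar>measure ?DD ?E - Phi 0\<bar>
      \<le> C / sqrt (real n) * (integral\<^sup>L D (\<lambda>t. \<bar>t\<bar> ^ 3) / (integral\<^sup>L D (\<lambda>t. t\<^sup>2)) powr (3 / 2))"
  proof -
    have "0 < integral\<^sup>L D (\<lambda>t. t\<^sup>2)" using moments var by simp
    then show ?thesis
      using BE[unfolded berry_esseen_const_def, THEN conjunct2, rule_format, of D n 0] D ints moments(1) n
      by blast
  qed
  \<comment> \<open>The product of the image laws is the image of the product law under the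
    coordinatewise map, which brings the event back to samples from \<open>P\<close>.\<close>
  have DD: "?DD = distr ?PP ?DD (compose {..<n} (\<lambda>x. - Y x))"
  proof -
    have "?DD = PiM {..<n} (\<lambda>_. distr P D (\<lambda>x. - Y x))"
      by (intro PiM_cong refl) (auto simp: D_def intro: distr_cong)
    also have "\<dots> = distr ?PP ?DD (compose {..<n} (\<lambda>x. - Y x))"
      by (intro distr_PiM_finite_prob_space'[symmetric]) (use P D in \<open>auto simp: measurable_cong_sets[OF refl D(2)]\<close>)
    finally show ?thesis .
  qed
  have meas: "compose {..<n} (\<lambda>x. - Y x) \<in> measurable ?PP ?DD"
    unfolding compose_def by (intro measurable_restrict) (auto simp: measurable_cong_sets[OF refl D(2)])
  have E: "?E \<in> sets ?DD"
  proof -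
    have [measurable]: "(\<lambda>\<omega>. \<omega> i) \<in> borel_measurable ?DD" if "i \<in> {..<n}" for i
      using measurable_component_singleton[OF that, of "\<lambda>_. D"] by (simp add: measurable_cong_sets[OF refl D(2)])
    show ?thesis by measurable
  qed
  have sqrt_pos: "0 < sqrt (real n * integral\<^sup>L D (\<lambda>t. t\<^sup>2))"
    using n var moments by simp
  have "measure ?DD ?E = measure (distr ?PP ?DD (compose {..<n} (\<lambda>x. - Y x))) ?E"
    using DD by simp
  also have "\<dots> = measure ?PP (compose {..<n} (\<lambda>x. - Y x) -` ?E \<inter> space ?PP)"
    using meas E by (rule measure_distr)
  also have "compose {..<n} (\<lambda>x. - Y x) -` ?E \<inter> space ?PP = {\<omega> \<in> space ?PP. 0 \<le> (\<Sum>i<n. Y (\<omega> i))}"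
    using measurable_space[OF meas] sqrt_pos
    by (auto simp: compose_def sum_negf divide_le_0_iff)
  finally show ?thesis
    using bound unfolding Phi_0 moments by linarith
qed

section \<open>Exponential families as exponential tilts\<close>

lemma prob_space_ef_dist:
  assumes sets: "sets M = sets borel" and [measurable]: "u \<in> borel_measurable borel" "v \<in> borel_measurable borel"
    and norm: "(\<integral>\<^sup>+ x. ennreal (ef_pdf u v \<eta> \<zeta> t x) \<partial>M) = 1"
  shows "prob_space (ef_dist M u v \<eta> \<zeta> t)"
proof (rule prob_spaceI)
  note [measurable_cong] = sets
  have [measurable]: "ef_pdf u v \<eta> \<zeta> t \<in> borel_measurable M"
    unfolding ef_pdf_def by measurable
  have "emeasure (ef_dist M u v \<eta> \<zeta> t) (space M) = (\<integral>\<^sup>+ x. ennreal (ef_pdf u v \<eta> \<zeta> t x) \<partial>M)"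
    unfolding ef_dist_def by (subst emeasure_density) (auto intro!: nn_integral_cong)
  then show "emeasure (ef_dist M u v \<eta> \<zeta> t) (space (ef_dist M u v \<eta> \<zeta> t)) = 1"
    using norm by (simp add: ef_dist_def)
qed

text \<open>The factor \<open>v\<close> is common to both pdfs, and their exponents differ by an
  affine function of \<open>u\<close>. Expanding it around \<open>z\<close> leaves
  \<open>ef_rho\<close> as the constant term. The identity is multiplicative, so zeros of
  \<open>v\<close> do no harm.\<close>

lemma ef_dist_exp_tilt:
  assumes sets: "sets M = sets borel" and [measurable]: "u \<in> borel_measurable borel" "v \<in> borel_measurable borel"
    and v: "\<forall>x. 0 \<le> v x"
  shows "ef_dist M u v \<eta> \<zeta> t = density (ef_dist M u v \<eta> \<zeta> a)
    (\<lambda>x. ennreal (exp (ef_rho \<eta> \<zeta> t z a - (\<eta> a - \<eta> t) * (u x - z))))"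
proof -
  note [measurable_cong] = sets
  have [measurable]: "ef_pdf u v \<eta> \<zeta> s \<in> borel_measurable M" for s
    unfolding ef_pdf_def by measurable
  have "ef_pdf u v \<eta> \<zeta> t x = ef_pdf u v \<eta> \<zeta> a x * exp (ef_rho \<eta> \<zeta> t z a - (\<eta> a - \<eta> t) * (u x - z))" for x
    unfolding ef_pdf_def ef_rho_def by (simp add: mult_exp_exp mult.assoc algebra_simps)
  moreover have "0 \<le> ef_pdf u v \<eta> \<zeta> s x" for s x
    using v by (simp add: ef_pdf_def)
  ultimately show ?thesis
    unfolding ef_dist_def by (subst density_density_eq) (auto simp: ennreal_mult)
qed

text \<open>The parameter \<open>s\<close> is free because the sample space is the same for all
  parameters; this lets two laws be compared on one and the same event.\<close>

lemma Pr_ge_eq_sum: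
  assumes "m > 0"
  shows "Pr_ge M u v \<eta> \<zeta> m t z = measure (PiM {..<m} (\<lambda>_. ef_dist M u v \<eta> \<zeta> t))
    {\<omega> \<in> space (PiM {..<m} (\<lambda>_. ef_dist M u v \<eta> \<zeta> s)). 0 \<le> (\<Sum>i<m. u (\<omega> i) - z)}"
proof -
  have "space (PiM {..<m} (\<lambda>_. ef_dist M u v \<eta> \<zeta> t)) = space (PiM {..<m} (\<lambda>_. ef_dist M u v \<eta> \<zeta> s))"
    by (simp add: space_PiM ef_dist_def)
  then show ?thesis
    using assms by (simp add: Pr_ge_def ef_sample_def Zbar_def sum_subtractf pos_le_divide_eq mult.commute)
qed

text \<open>Negating \<open>u\<close> and \<eta> together leaves every pdf unchanged and reverses
  the sign of the sample mean.\<close>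

lemma Pr_le_eq_Pr_ge_uminus:
  "Pr_le M u v \<eta> \<zeta> m t z = Pr_ge M (\<lambda>x. - u x) v (\<lambda>t. - \<eta> t) \<zeta> m t (- z)"
  by (simp add: Pr_le_def Pr_ge_def ef_sample_def ef_dist_def ef_pdf_def Zbar_def sum_negf)

text \<open>All four claims come from one picture: the law at \<theta> is the tilt of the law
  \<open>P\<close> at \<alpha> by \<open>exp (r - a * Y)\<close>, where \<open>Y = u - z\<close> is
  centred under \<open>P\<close>. The lower tails are later obtained by applying these claims to the
  reflected family.\<close>

lemma ef_upper_tail:
  assumes sets: "sets M = sets borel" and u: "u \<in> borel_measurable borel" and v: "v \<in> borel_measurable borel"
    and v_nonneg: "\<forall>x. 0 \<le> v x"
    and norm: "(\<integral>\<^sup>+ x. ennreal (ef_pdf u v \<eta> \<zeta> \<theta> x) \<partial>M) = 1" "(\<integral>\<^sup>+ x. ennreal (ef_pdf u v \<eta> \<zeta> \<alpha> x) \<partial>M) = 1"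
    and int: "integrable (ef_dist M u v \<eta> \<zeta> \<theta>) u" "integrable (ef_dist M u v \<eta> \<zeta> \<alpha>) u"
    and z: "z = ef_mean M u v \<eta> \<zeta> \<alpha>" and BE: "berry_esseen_const C" and n: "1 \<le> n"
  shows ef_upper_tail_chernoff: "\<lbrakk>ef_mean M u v \<eta> \<zeta> \<theta> \<le> z; measure (ef_dist M u v \<eta> \<zeta> \<theta>) {x. u x < z} > 0\<rbrakk>
      \<Longrightarrow> Pr_ge M u v \<eta> \<zeta> n \<theta> z \<le> exp (real n * ef_rho \<eta> \<zeta> \<theta> z \<alpha>)"
    and ef_upper_tail_log_limit: "\<lbrakk>ef_mean M u v \<eta> \<zeta> \<theta> \<le> z; measure (ef_dist M u v \<eta> \<zeta> \<theta>) {x. u x < z} > 0\<rbrakk>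
      \<Longrightarrow> (\<lambda>m. ln (Pr_ge M u v \<eta> \<zeta> m \<theta> z) / real m) \<longlonglongrightarrow> ef_rho \<eta> \<zeta> \<theta> z \<alpha>"
    and ef_upper_tail_change_of_measure: "\<eta> \<theta> \<le> \<eta> \<alpha> \<Longrightarrow>
      Pr_ge M u v \<eta> \<zeta> n \<theta> z \<le> exp (real n * ef_rho \<eta> \<zeta> \<theta> z \<alpha>) * Pr_ge M u v \<eta> \<zeta> n \<alpha> z"
    and ef_upper_tail_at_mean: "Pr_ge M u v \<eta> \<zeta> n \<alpha> z \<le> 1 / 2 + ef_Delta M u v \<eta> \<zeta> C n \<alpha> z"
proof -
  note [measurable] = u v and [measurable_cong] = sets
  define P where "P = ef_dist M u v \<eta> \<zeta> \<alpha>"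
  define Y where "Y x = u x - z" for x
  define r where "r = ef_rho \<eta> \<zeta> \<theta> z \<alpha>"
  define a where "a = \<eta> \<alpha> - \<eta> \<theta>"
  have P: "prob_space P" unfolding P_def by (rule prob_space_ef_dist[OF sets u v norm(2)])
  interpret P: prob_space P by fact
  have sets_P [measurable_cong]: "sets P = sets borel" using sets by (simp add: P_def ef_dist_def)
  have space_P: "space P = UNIV" using sets_eq_imp_space_eq[OF sets_P] by simp
  have [measurable]: "Y \<in> borel_measurable P" unfolding Y_def by measurable
  have tilt: "ef_dist M u v \<eta> \<zeta> \<theta> = density P (\<lambda>x. ennreal (exp (r - a * Y x)))"
    unfolding P_def r_def a_def Y_def by (rule ef_dist_exp_tilt[OF sets u v v_nonneg])
  have Q: "prob_space (density P (\<lambda>x. ennreal (exp (r - a * Y x))))"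
    unfolding tilt[symmetric] by (rule prob_space_ef_dist[OF sets u v norm(1)])
  interpret Q: prob_space "density P (\<lambda>x. ennreal (exp (r - a * Y x)))" by fact
  have Y: "integrable P Y"
    using int(2) unfolding Y_def P_def[symmetric] by simp
  have mean: "integral\<^sup>L P Y = 0"
    using int(2) unfolding Y_def P_def[symmetric] by (simp add: z ef_mean_def P_def[symmetric] P.prob_space)
  have Pr\<theta>: "Pr_ge M u v \<eta> \<zeta> m \<theta> z = measure (PiM {..<m} (\<lambda>_. density P (\<lambda>x. ennreal (exp (r - a * Y x)))))
      {\<omega> \<in> space (PiM {..<m} (\<lambda>_. P)). 0 \<le> (\<Sum>i<m. Y (\<omega> i))}" if "m > 0" for m
    unfolding Pr_ge_eq_sum[OF that, where s=\<alpha>] tilt by (simp add: P_def Y_def)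
  have Pr\<alpha>: "Pr_ge M u v \<eta> \<zeta> n \<alpha> z = measure (PiM {..<n} (\<lambda>_. P))
      {\<omega> \<in> space (PiM {..<n} (\<lambda>_. P)). 0 \<le> (\<Sum>i<n. Y (\<omega> i))}"
    using n by (subst Pr_ge_eq_sum[where s=\<alpha>]) (simp_all add: P_def Y_def)
  have Pr\<alpha>_le_1: "Pr_ge M u v \<eta> \<zeta> n \<alpha> z \<le> 1"
    unfolding Pr\<alpha> by (intro prob_space.prob_le_1 prob_space_PiM P)
  have change: "Pr_ge M u v \<eta> \<zeta> n \<theta> z \<le> exp (real n * r) * Pr_ge M u v \<eta> \<zeta> n \<alpha> z" if "0 \<le> a"
    unfolding Pr\<alpha> using n that by (subst Pr\<theta>) (auto intro!: exp_tilt_upper_tail_le[OF P Q])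
  then show "\<eta> \<theta> \<le> \<eta> \<alpha> \<Longrightarrow>
      Pr_ge M u v \<eta> \<zeta> n \<theta> z \<le> exp (real n * ef_rho \<eta> \<zeta> \<theta> z \<alpha>) * Pr_ge M u v \<eta> \<zeta> n \<alpha> z"
    by (simp add: a_def r_def)
  \<comment> \<open>Whenever \<open>ef_Delta\<close> equals \<open>1 / 2\<close>, the claim only
    says that a probability is at most 1; Berry-Esseen settles the remaining case.\<close>
  show "Pr_ge M u v \<eta> \<zeta> n \<alpha> z \<le> 1 / 2 + ef_Delta M u v \<eta> \<zeta> C n \<alpha> z"
  proof (cases "integrable P (\<lambda>x. \<bar>u x - z\<bar> ^ 3) \<and> 0 < (\<integral>x. \<bar>u x - z\<bar> ^ 2 \<partial>P)")
    case True
    then have "Pr_ge M u v \<eta> \<zeta> n \<alpha> z \<le> 1 / 2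
        + C / sqrt (real n) * ((\<integral>x. \<bar>Y x\<bar> ^ 3 \<partial>P) / (\<integral>x. (Y x)\<^sup>2 \<partial>P) powr (3 / 2))"
      unfolding Pr\<alpha> using n by (intro berry_esseen_upper_tail[OF BE P _ _ Y mean]) (auto simp: Y_def)
    then show ?thesis
      using True Pr\<alpha>_le_1 by (simp add: ef_Delta_def Let_def P_def[symmetric] Y_def min_def)
  next
    case False
    then have "ef_Delta M u v \<eta> \<zeta> C n \<alpha> z = 1 / 2"
      unfolding ef_Delta_def Let_def P_def[symmetric] by (rule if_not_P)
    then show ?thesis using Pr\<alpha>_le_1 by simp
  qed
  assume le: "ef_mean M u v \<eta> \<zeta> \<theta> \<le> z" and pos: "measure (ef_dist M u v \<eta> \<zeta> \<theta>) {x. u x < z} > 0"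
  \<comment> \<open>The tilted law is absolutely continuous with respect to \<open>P\<close>, so
    \<open>Y = 0\<close> almost everywhere would make \<open>u < z\<close> a null event at \<theta>
    as well.\<close>
  have nondeg: "\<not> (AE x in P. Y x = 0)"
  proof
    assume "AE x in P. Y x = 0"
    then have "AE x in density P (\<lambda>x. ennreal (exp (r - a * Y x))). x \<notin> {x. u x < z}"
      by (subst AE_density) (auto simp: Y_def)
    moreover have "{x. u x < z} \<in> sets P"
      using measurable_sets[of u borel borel "{..<z}"] u by (simp add: sets_P vimage_def)
    ultimately have "measure (ef_dist M u v \<eta> \<zeta> \<theta>) {x. u x < z} = 0"
      unfolding tilt by (subst Q.prob_eq_0) auto
    then show False using pos by simp
  qed
  interpret T: prob_space "ef_dist M u v \<eta> \<zeta> \<theta>"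
    by (rule prob_space_ef_dist[OF sets u v norm(1)])
  have "integrable (ef_dist M u v \<eta> \<zeta> \<theta>) Y"
    using int(1) unfolding Y_def by simp
  then have int_tilt: "integrable (density P (\<lambda>x. ennreal (exp (r - a * Y x)))) Y"
    unfolding tilt .
  have "integral\<^sup>L (ef_dist M u v \<eta> \<zeta> \<theta>) Y = ef_mean M u v \<eta> \<zeta> \<theta> - z"
    using int(1) T.prob_space unfolding Y_def ef_mean_def by simp
  then have "integral\<^sup>L (density P (\<lambda>x. ennreal (exp (r - a * Y x)))) Y \<le> 0"
    using le unfolding tilt[symmetric] by simp
  \<comment> \<open>The mean of \<open>Y\<close> under the tilted law is \<open>ef_mean\<close> at
    \<theta> minus \<open>z\<close>, hence at most 0. The sign of \<open>a\<close> follows, and the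
    claims reduce to the case \<open>\<eta> \<theta> \<le> \<eta> \<alpha>\<close>.\<close>
  then have a: "0 \<le> a"
    using int_tilt by (intro exp_tilt_nonneg_rate[OF Y mean nondeg, of r]) (simp_all add: integrable_density integral_density)
  have "Pr_ge M u v \<eta> \<zeta> n \<theta> z \<le> exp (real n * r) * Pr_ge M u v \<eta> \<zeta> n \<alpha> z"
    by (rule change[OF a])
  also have "\<dots> \<le> exp (real n * r) * 1"
    using Pr\<alpha>_le_1 by (intro mult_left_mono) auto
  finally show "Pr_ge M u v \<eta> \<zeta> n \<theta> z \<le> exp (real n * ef_rho \<eta> \<zeta> \<theta> z \<alpha>)"
    by (simp add: r_def)
  \<comment> \<open>The sum form of the tail event is available only for positive \<open>m\<close>,
    which is enough for the limit.\<close>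
  have "eventually (\<lambda>m. ln (measure (PiM {..<m} (\<lambda>_. density P (\<lambda>x. ennreal (exp (r - a * Y x)))))
        {\<omega> \<in> space (PiM {..<m} (\<lambda>_. P)). 0 \<le> (\<Sum>i<m. Y (\<omega> i))}) / real m
      = ln (Pr_ge M u v \<eta> \<zeta> m \<theta> z) / real m) sequentially"
    using eventually_gt_at_top[of 0] by eventually_elim (simp add: Pr\<theta>)
  then show "(\<lambda>m. ln (Pr_ge M u v \<eta> \<zeta> m \<theta> z) / real m) \<longlonglongrightarrow> ef_rho \<eta> \<zeta> \<theta> z \<alpha>"
    using exp_tilt_upper_tail_log_limit[OF P Q Y mean nondeg a] unfolding r_def[symmetric]
    by (rule Lim_transform_eventually[rotated])
qed

theorem theorem5:
  fixes M :: "real measure" and u v \<eta> \<zeta> :: "real \<Rightarrow> real" and \<Theta> :: "real set"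
    and \<theta> \<alpha> z C :: real and n :: nat
  assumes base: "M = lborel \<or> (\<exists>S. countable S \<and> M = distr (count_space S) borel (\<lambda>x. x))"
    and u_meas: "u \<in> borel_measurable borel" and v_meas: "v \<in> borel_measurable borel"
    and v_nonneg: "\<forall>x. v x \<ge> 0"
    and normalized: "\<forall>t\<in>\<Theta>. (\<integral>\<^sup>+ x. ennreal (ef_pdf u v \<eta> \<zeta> t x) \<partial>M) = 1"
    and mean_exists: "\<forall>t\<in>\<Theta>. integrable (ef_dist M u v \<eta> \<zeta> t) u"
    and eta_diff: "\<eta> differentiable_on \<Theta>" and zeta_diff: "\<zeta> differentiable_on \<Theta>"
    and theta: "\<theta> \<in> \<Theta>" and alpha: "\<alpha> \<in> \<Theta>"
    and z_def: "z = ef_mean M u v \<eta> \<zeta> \<alpha>"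
    and BE: "berry_esseen_const C"
    and n: "n \<ge> 1"
  shows
   "(ef_mean M u v \<eta> \<zeta> \<theta> \<le> z \<and> measure (ef_dist M u v \<eta> \<zeta> \<theta>) {x. u x < z} > 0 \<longrightarrow>
       Pr_ge M u v \<eta> \<zeta> n \<theta> z \<le> exp (real n * ef_rho \<eta> \<zeta> \<theta> z \<alpha>) \<and>
       (\<lambda>m. ln (Pr_ge M u v \<eta> \<zeta> m \<theta> z) / real m) \<longlonglongrightarrow> ef_rho \<eta> \<zeta> \<theta> z \<alpha>)
  \<and> (ef_mean M u v \<eta> \<zeta> \<theta> \<ge> z \<and> measure (ef_dist M u v \<eta> \<zeta> \<theta>) {x. u x > z} > 0 \<longrightarrow>
       Pr_le M u v \<eta> \<zeta> n \<theta> z \<le> exp (real n * ef_rho \<eta> \<zeta> \<theta> z \<alpha>) \<and>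
       (\<lambda>m. ln (Pr_le M u v \<eta> \<zeta> m \<theta> z) / real m) \<longlonglongrightarrow> ef_rho \<eta> \<zeta> \<theta> z \<alpha>)
  \<and> (\<eta> \<theta> \<le> \<eta> \<alpha> \<longrightarrow>
       Pr_ge M u v \<eta> \<zeta> n \<theta> z \<le> exp (real n * ef_rho \<eta> \<zeta> \<theta> z \<alpha>) * Pr_ge M u v \<eta> \<zeta> n \<alpha> z \<and>
       exp (real n * ef_rho \<eta> \<zeta> \<theta> z \<alpha>) * Pr_ge M u v \<eta> \<zeta> n \<alpha> z
         \<le> (1/2 + ef_Delta M u v \<eta> \<zeta> C n \<alpha> z) * exp (real n * ef_rho \<eta> \<zeta> \<theta> z \<alpha>))
  \<and> (\<eta> \<theta> \<ge> \<eta> \<alpha> \<longrightarrow>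
       Pr_le M u v \<eta> \<zeta> n \<theta> z \<le> exp (real n * ef_rho \<eta> \<zeta> \<theta> z \<alpha>) * Pr_le M u v \<eta> \<zeta> n \<alpha> z \<and>
       exp (real n * ef_rho \<eta> \<zeta> \<theta> z \<alpha>) * Pr_le M u v \<eta> \<zeta> n \<alpha> z
         \<le> (1/2 + ef_Delta M u v \<eta> \<zeta> C n \<alpha> z) * exp (real n * ef_rho \<eta> \<zeta> \<theta> z \<alpha>))"
proof -
  have sets: "sets M = sets borel" using base by auto
  \<comment> \<open>Under the reflection of \<open>u\<close>, \<eta> and \<open>z\<close> the laws,
    \<open>ef_rho\<close> and \<open>ef_Delta\<close> are invariant, while the mean changes
    sign.\<close>
  have pdf_uminus: "ef_pdf (\<lambda>x. - u x) v (\<lambda>t. - \<eta> t) \<zeta> = ef_pdf u v \<eta> \<zeta>"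
    by (simp add: ef_pdf_def fun_eq_iff)
  have dist_uminus: "ef_dist M (\<lambda>x. - u x) v (\<lambda>t. - \<eta> t) \<zeta> = ef_dist M u v \<eta> \<zeta>"
    by (simp add: ef_dist_def fun_eq_iff pdf_uminus)
  have mean_uminus: "ef_mean M (\<lambda>x. - u x) v (\<lambda>t. - \<eta> t) \<zeta> t = - ef_mean M u v \<eta> \<zeta> t" for t
    by (simp add: ef_mean_def dist_uminus)
  have rho_uminus: "ef_rho (\<lambda>t. - \<eta> t) \<zeta> \<theta> (- z) \<alpha> = ef_rho \<eta> \<zeta> \<theta> z \<alpha>"
    by (simp add: ef_rho_def algebra_simps)
  have abs_uminus: "\<bar>z - u x\<bar> = \<bar>u x - z\<bar>" for x
    by (rule abs_minus_commute)
  have Delta_uminus: "ef_Delta M (\<lambda>x. - u x) v (\<lambda>t. - \<eta> t) \<zeta> C n \<alpha> (- z) = ef_Delta M u v \<eta> \<zeta> C n \<alpha> z"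
    unfolding ef_Delta_def dist_uminus by (simp add: abs_uminus)
  have norm: "(\<integral>\<^sup>+ x. ennreal (ef_pdf u v \<eta> \<zeta> \<theta> x) \<partial>M) = 1" "(\<integral>\<^sup>+ x. ennreal (ef_pdf u v \<eta> \<zeta> \<alpha> x) \<partial>M) = 1"
    and int: "integrable (ef_dist M u v \<eta> \<zeta> \<theta>) u" "integrable (ef_dist M u v \<eta> \<zeta> \<alpha>) u"
    using normalized mean_exists theta alpha by auto
  note upper = ef_upper_tail[OF sets u_meas v_meas v_nonneg norm int z_def BE n]
  have "(\<lambda>x. - u x) \<in> borel_measurable borel" using u_meas by measurable
  moreover have "integrable (ef_dist M u v \<eta> \<zeta> t) (\<lambda>x. - u x)" if "t \<in> \<Theta>" for t
    using mean_exists that by simp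
  ultimately have lower_assms: "(\<lambda>x. - u x) \<in> borel_measurable borel"
      "integrable (ef_dist M u v \<eta> \<zeta> \<theta>) (\<lambda>x. - u x)" "integrable (ef_dist M u v \<eta> \<zeta> \<alpha>) (\<lambda>x. - u x)"
      "- z = - ef_mean M u v \<eta> \<zeta> \<alpha>"
    using theta alpha z_def by auto
  \<comment> \<open>The reflection reverses the order of the means and of the natural parameters and
    turns \<open>u x < z\<close> into \<open>u x > z\<close>, which are exactly the hypotheses of
    the lower-tail claims.\<close>
  note lower = ef_upper_tail[of M "\<lambda>x. - u x" v "\<lambda>t. - \<eta> t" \<zeta> \<theta> \<alpha> "- z" C n,
      unfolded pdf_uminus dist_uminus mean_uminus rho_uminus Delta_uminus Pr_le_eq_Pr_ge_uminus[symmetric],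
      OF sets lower_assms(1) v_meas v_nonneg norm lower_assms(2-4) BE n]
  show ?thesis
    using upper lower by (auto simp: mult.commute[of "exp _"])
qed

end
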